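(* Let $H$ be a real Hilbert space and $T:H\rightrightarrows H$ maximal monotone. Let $z,\tilde z,v\in H$, $\lambda>0$, $\sigma\in[0,1)$, $t\in[0,1]$, $\varepsilon>0$ be such that $$v\in T^{[\varepsilon]}(\tilde z),\qquad \|\lambda v+\tilde z-z\|^2+2\lambda\varepsilon\le\sigma^2\|\tilde z-z\|^2 .$$ Define $z_+=z-t\lambda v$ and $\gamma:H\to\mathbb{R}$, $\gamma(z')=\langle z'-\tilde z,v\rangle-\varepsilon$. Then: 1. $(1-\sigma)\|\tilde z-z\|\le\|\lambda v\|\le(1+\sigma)\|\tilde z-z\|$ and $2\lambda\varepsilon\le\sigma^2\|\tilde z-z\|^2$; 2. $z_+=\operatorname{argmin}_{z'\in H}\; t\lambda\gamma(z')+\tfrac12\|z'-z\|^2$ (i.e. $z_+$ is the unique minimizer); 3. $\min_{z'\in H}\; t\lambda\gamma(z')+\tfrac12\|z'-z\|^2\ \ge\ \tfrac12\Big((1-\sigma^2)t\|\tilde z-z\|^2+t(1-t)\|\lambda v\|^2\Big)$; 4. for any $z^*\in T^{-1}(0)$, $\gamma(z^* )\le0$ and $\|z-z^*\|^2\ge\|z_+-z^*\|^2+(1-\sigma^2)t\|\tilde z-z\|^2+t(1-t)\|\lambda v\|^2$; 5. for any $z^*\in T^{-1}(0)$, $\|z^*-\tilde z\|\le\|z^*-z\|/\sqrt{1-\sigma^2}$ and $\|\tilde z-z\|\le\|z^*-z\|/\sqrt{1-\sigma^2}$.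
   Context: A point-to-set operator $T:H\rightrightarrows H$ is a relation $T\subset H\times H$, with $T(z)=\{v : (z,v)\in T\}$ and $T^{-1}(0)=\{z : 0\in T(z)\}$. It is monotone if $\langle z-z',v-v'\rangle\ge0$ for all $(z,v),(z',v')\in T$, and maximal monotone if it is maximal, with respect to inclusion, among monotone operators. For $\varepsilon\ge0$ the $\varepsilon$-enlargement of $T$ is $T^{[\varepsilon]}(z)=\{v : \langle z-z',v-v'\rangle\ge-\varepsilon\ \ \forall (z',v')\in T\}$, $z\in H$. *)

theory Defs
  imports "HOL-Analysis.Analysis"
begin

text \<open>
  A point-to-set operator on a space is a relation \<open>T\<close>; its value at \<open>z\<close> is the
  relational image \<open>T `` {z}\<close>.
\<close>

definition monotone_operator :: "('a::real_inner \<times> 'a) set \<Rightarrow> bool" where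
  "monotone_operator T \<longleftrightarrow>
     (\<forall>(z, v) \<in> T. \<forall>(z', v') \<in> T. inner (z - z') (v - v') \<ge> 0)"

definition maximal_monotone_operator :: "('a::real_inner \<times> 'a) set \<Rightarrow> bool" where
  "maximal_monotone_operator T \<longleftrightarrow>
     monotone_operator T \<and> (\<forall>S. monotone_operator S \<and> T \<subseteq> S \<longrightarrow> S = T)"

definition operator_zeros :: "('a::real_inner \<times> 'a) set \<Rightarrow> 'a set" where
  "operator_zeros T = {z. 0 \<in> T `` {z}}"

text \<open>The enlargement is meant for \<open>\<epsilon> \<ge> 0\<close>.\<close>

definition enlargement :: "real \<Rightarrow> ('a::real_inner \<times> 'a) set \<Rightarrow> 'a \<Rightarrow> 'a set" where
  "enlargement \<epsilon> T z = {v. \<forall>(z', v') \<in> T. inner (z - z') (v - v') \<ge> - \<epsilon>}"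

end

theory Submission
  imports Defs
begin

text \<open>
  The point \<open>z - s v\<close> is one gradient step from \<open>z\<close> for the affine function
  \<open>\<gamma>(x) = \<langle>x - zt, v\<rangle> - \<epsilon>\<close>. Adding \<open>\<parallel>x - z\<parallel>\<^sup>2 / 2\<close> to \<open>s \<gamma>\<close> gives a quadratic with identity
  Hessian, so it equals its value at \<open>z - s v\<close> plus half the squared distance to that point
  (\<open>affine_prox_decomposition\<close>). This identity identifies the unique minimizer and the minimum.

  Expanding the square in the relative error criterion bounds the minimum from below
  (\<open>prox_value_lower_bound\<close>). A zero of \<open>T\<close> lies in the half space \<open>\<gamma> \<le> 0\<close>, so the
  regularized function at the zero is at most half of the squared distance from the zero to \<open>z\<close>;
  together with the decomposition and the lower bound this is the decrease of the distance to
  the zeros (\<open>relaxed_step_decrease\<close>).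

  The distance bounds do not involve \<open>t\<close>: both come from the decrease for the full step
  \<open>t = 1\<close>, whose endpoint is within \<open>\<sigma> \<parallel>zt - z\<parallel>\<close> of \<open>zt\<close>. The triangle inequality through that
  endpoint and a scalar Cauchy-Schwarz inequality give the factor \<open>1 / sqrt (1 - \<sigma>\<^sup>2)\<close>.
\<close>

lemma affine_prox_decomposition:
  fixes x z zt v :: "'a::real_inner"
  shows "s * (inner (x - zt) v - \<epsilon>) + 1 / 2 * (norm (x - z))\<^sup>2 =
         s * (inner ((z - s *\<^sub>R v) - zt) v - \<epsilon>) + 1 / 2 * (norm ((z - s *\<^sub>R v) - z))\<^sup>2
         + 1 / 2 * (norm (x - (z - s *\<^sub>R v)))\<^sup>2"
  unfolding power2_norm_eq_inner
  by (simp add: inner_add_left inner_add_right inner_diff_left inner_diff_right inner_commute)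
    (simp add: field_simps)

text \<open>
  With \<open>a = zt - z\<close> and \<open>w = lam v\<close>, the value at the minimizer is
  \<open>- t \<langle>a, w\<rangle> - t lam \<epsilon> - t\<^sup>2 \<parallel>w\<parallel>\<^sup>2 / 2\<close>, and expanding \<open>\<parallel>w + a\<parallel>\<^sup>2\<close> in the error criterion bounds
  \<open>- \<langle>a, w\<rangle> - lam \<epsilon>\<close> from below by \<open>((1 - \<sigma>\<^sup>2) \<parallel>a\<parallel>\<^sup>2 + \<parallel>w\<parallel>\<^sup>2) / 2\<close>.
\<close>

lemma prox_value_lower_bound:
  fixes z zt v :: "'a::real_inner"
  assumes "0 \<le> t"
    and err: "(norm (lam *\<^sub>R v + zt - z))\<^sup>2 + 2 * lam * \<epsilon> \<le> \<sigma>\<^sup>2 * (norm (zt - z))\<^sup>2"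
  shows "1 / 2 * ((1 - \<sigma>\<^sup>2) * t * (norm (zt - z))\<^sup>2 + t * (1 - t) * (norm (lam *\<^sub>R v))\<^sup>2)
         \<le> t * lam * (inner ((z - (t * lam) *\<^sub>R v) - zt) v - \<epsilon>)
           + 1 / 2 * (norm ((z - (t * lam) *\<^sub>R v) - z))\<^sup>2"
proof -
  define a w where "a = zt - z" and "w = lam *\<^sub>R v"
  have "(norm (w + a))\<^sup>2 + 2 * lam * \<epsilon> \<le> \<sigma>\<^sup>2 * (norm a)\<^sup>2"
    using err unfolding a_def w_def by (simp only: add_diff_eq)
  then have "(1 - \<sigma>\<^sup>2) * (norm a)\<^sup>2 + (norm w)\<^sup>2 \<le> - 2 * inner a w - 2 * lam * \<epsilon>"
    by (simp add: power2_norm_eq_inner inner_add_left inner_add_right inner_commute algebra_simps)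
  then have "t * ((1 - \<sigma>\<^sup>2) * (norm a)\<^sup>2 + (norm w)\<^sup>2) \<le> t * (- 2 * inner a w - 2 * lam * \<epsilon>)"
    using \<open>0 \<le> t\<close> by (rule mult_left_mono)
  then have main: "1 / 2 * ((1 - \<sigma>\<^sup>2) * t * (norm a)\<^sup>2 + t * (1 - t) * (norm w)\<^sup>2)
      \<le> - t * inner a w - t * lam * \<epsilon> - t\<^sup>2 / 2 * (norm w)\<^sup>2"
    by (simp add: field_simps power2_eq_square)
  have step: "(z - (t * lam) *\<^sub>R v) - zt = - a - t *\<^sub>R w" "(z - (t * lam) *\<^sub>R v) - z = - t *\<^sub>R w"
    by (simp_all add: a_def w_def)
  have "t * lam * (inner (- a - t *\<^sub>R w) v - \<epsilon>) = t * (inner (- a - t *\<^sub>R w) w) - t * lam * \<epsilon>"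
    by (simp add: w_def algebra_simps)
  also have "\<dots> = - t * inner a w - t * lam * \<epsilon> - t\<^sup>2 * (norm w)\<^sup>2"
    by (simp add: dot_square_norm inner_diff_left algebra_simps power2_eq_square)
  finally show ?thesis
    using main unfolding step a_def[symmetric] w_def[symmetric]
    by (simp add: power_mult_distrib)
qed

lemma enlargement_separates_zeros:
  assumes "v \<in> enlargement \<epsilon> T zt" and "zs \<in> operator_zeros T"
  shows "inner (zs - zt) v - \<epsilon> \<le> 0"
proof -
  have "(zs, 0) \<in> T"
    using assms(2) by (simp add: operator_zeros_def)
  then have "inner (zt - zs) (v - 0) \<ge> - \<epsilon>"
    using assms(1) unfolding enlargement_def by fastforce
  then show ?thesis
    by (simp add: inner_diff_left)
qed

lemma relaxed_step_decrease:
  fixes z zt v zs :: "'a::real_inner"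
  assumes "0 \<le> t" and "0 \<le> lam"
    and err: "(norm (lam *\<^sub>R v + zt - z))\<^sup>2 + 2 * lam * \<epsilon> \<le> \<sigma>\<^sup>2 * (norm (zt - z))\<^sup>2"
    and neg: "inner (zs - zt) v - \<epsilon> \<le> 0"
  shows "(norm ((z - (t * lam) *\<^sub>R v) - zs))\<^sup>2 + (1 - \<sigma>\<^sup>2) * t * (norm (zt - z))\<^sup>2
         + t * (1 - t) * (norm (lam *\<^sub>R v))\<^sup>2 \<le> (norm (z - zs))\<^sup>2"
proof -
  have "t * lam * (inner (zs - zt) v - \<epsilon>) \<le> 0"
    using assms by (simp add: mult_nonneg_nonpos)
  then show ?thesis
    using affine_prox_decomposition[of "t * lam" zs zt v \<epsilon> z]
      prox_value_lower_bound[OF \<open>0 \<le> t\<close> err]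
    by (simp only: norm_minus_commute[of zs]) argo
qed

text \<open>
  For \<open>\<sigma>\<^sup>2 < 1\<close>, writing \<open>p + \<sigma> a\<close> as
  \<open>1 \<cdot> p + (\<sigma> / sqrt (1 - \<sigma>\<^sup>2)) \<cdot> (sqrt (1 - \<sigma>\<^sup>2) a)\<close> makes this Cauchy-Schwarz in the plane;
  the squared coefficients sum to \<open>1 / (1 - \<sigma>\<^sup>2)\<close>. The difference of the two sides is the
  square of \<open>\<sigma> p - (1 - \<sigma>\<^sup>2) a\<close>.
\<close>

lemma weighted_cauchy_schwarz_real:
  fixes p a \<sigma> :: real
  shows "(1 - \<sigma>\<^sup>2) * (p + \<sigma> * a)\<^sup>2 \<le> p\<^sup>2 + (1 - \<sigma>\<^sup>2) * a\<^sup>2"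
proof -
  have "p\<^sup>2 + (1 - \<sigma>\<^sup>2) * a\<^sup>2 - (1 - \<sigma>\<^sup>2) * (p + \<sigma> * a)\<^sup>2 = (\<sigma> * p - (1 - \<sigma>\<^sup>2) * a)\<^sup>2"
    by (simp add: power2_eq_square algebra_simps)
  then show ?thesis
    by (metis diff_ge_0_iff_ge zero_le_power2)
qed

lemma le_divide_sqrtI:
  fixes c x y :: real
  assumes "0 < c" and "0 \<le> y" and "c * x\<^sup>2 \<le> y\<^sup>2"
  shows "x \<le> y / sqrt c"
proof (rule power2_le_imp_le)
  show "x\<^sup>2 \<le> (y / sqrt c)\<^sup>2"
    using assms by (simp add: power_divide field_simps)
qed (use assms in simp)

text \<open>
  The full step decrease also controls the distance from the endpoint to the zero, which is the
  first leg of the path from the zero to \<open>zt\<close>; the second leg is the residual of the error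
  criterion.
\<close>

lemma distance_bounds_from_full_step:
  fixes z zt v zs :: "'a::real_inner"
  assumes "0 \<le> \<sigma>" and "\<sigma> < 1"
    and res: "norm (lam *\<^sub>R v + zt - z) \<le> \<sigma> * norm (zt - z)"
    and dec: "(norm ((z - lam *\<^sub>R v) - zs))\<^sup>2 + (1 - \<sigma>\<^sup>2) * (norm (zt - z))\<^sup>2 \<le> (norm (zs - z))\<^sup>2"
  shows "norm (zs - zt) \<le> norm (zs - z) / sqrt (1 - \<sigma>\<^sup>2)"
    and "norm (zt - z) \<le> norm (zs - z) / sqrt (1 - \<sigma>\<^sup>2)"
proof -
  have c: "0 < 1 - \<sigma>\<^sup>2"
    using assms(1,2) by (simp add: power_less_one_iff abs_square_less_1)
  define p where "p = norm ((z - lam *\<^sub>R v) - zs)"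
  have "zs - zt = - ((z - lam *\<^sub>R v) - zs) - (lam *\<^sub>R v + zt - z)"
    by simp
  then have "norm (zs - zt) \<le> p + norm (lam *\<^sub>R v + zt - z)"
    unfolding p_def by (metis norm_minus_cancel norm_triangle_ineq4)
  with res have "norm (zs - zt) \<le> p + \<sigma> * norm (zt - z)"
    by linarith
  then have "(1 - \<sigma>\<^sup>2) * (norm (zs - zt))\<^sup>2 \<le> (1 - \<sigma>\<^sup>2) * (p + \<sigma> * norm (zt - z))\<^sup>2"
    using c by (intro mult_left_mono power_mono) auto
  also have "\<dots> \<le> p\<^sup>2 + (1 - \<sigma>\<^sup>2) * (norm (zt - z))\<^sup>2"
    by (rule weighted_cauchy_schwarz_real)
  also have "\<dots> \<le> (norm (zs - z))\<^sup>2"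
    using dec by (simp add: p_def)
  finally show "norm (zs - zt) \<le> norm (zs - z) / sqrt (1 - \<sigma>\<^sup>2)"
    using c by (intro le_divide_sqrtI) auto
  have "(1 - \<sigma>\<^sup>2) * (norm (zt - z))\<^sup>2 \<le> (norm (zs - z))\<^sup>2"
    using dec zero_le_power2[of "norm ((z - lam *\<^sub>R v) - zs)"] by linarith
  then show "norm (zt - z) \<le> norm (zs - z) / sqrt (1 - \<sigma>\<^sup>2)"
    using c by (intro le_divide_sqrtI) auto
qed

theorem lemma2p1:
  fixes T :: "('a::{real_inner, complete_space} \<times> 'a) set"
    and z zt v zp :: 'a
    and lam \<sigma> t \<epsilon> :: real
    and \<gamma> :: "'a \<Rightarrow> real"
  assumes "maximal_monotone_operator T"
    and "lam > 0" and "0 \<le> \<sigma>" and "\<sigma> < 1" and "0 \<le> t" and "t \<le> 1" and "\<epsilon> > 0"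
    and "v \<in> enlargement \<epsilon> T zt"
    and "(norm (lam *\<^sub>R v + zt - z))\<^sup>2 + 2 * lam * \<epsilon> \<le> \<sigma>\<^sup>2 * (norm (zt - z))\<^sup>2"
    and "zp = z - (t * lam) *\<^sub>R v"
    and "\<gamma> = (\<lambda>z'. inner (z' - zt) v - \<epsilon>)"
  shows
    "((1 - \<sigma>) * norm (zt - z) \<le> norm (lam *\<^sub>R v) \<and>
      norm (lam *\<^sub>R v) \<le> (1 + \<sigma>) * norm (zt - z) \<and>
      2 * lam * \<epsilon> \<le> \<sigma>\<^sup>2 * (norm (zt - z))\<^sup>2) \<and>
     (\<forall>w. is_arg_min (\<lambda>z'. t * lam * \<gamma> z' + 1 / 2 * (norm (z' - z))\<^sup>2) (\<lambda>_. True) w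
            \<longleftrightarrow> w = zp) \<and>
     (LEAST m. m \<in> range (\<lambda>z'. t * lam * \<gamma> z' + 1 / 2 * (norm (z' - z))\<^sup>2))
        \<ge> 1 / 2 * ((1 - \<sigma>\<^sup>2) * t * (norm (zt - z))\<^sup>2 + t * (1 - t) * (norm (lam *\<^sub>R v))\<^sup>2) \<and>
     (\<forall>zs \<in> operator_zeros T.
        \<gamma> zs \<le> 0 \<and>
        (norm (z - zs))\<^sup>2 \<ge> (norm (zp - zs))\<^sup>2 + (1 - \<sigma>\<^sup>2) * t * (norm (zt - z))\<^sup>2
                             + t * (1 - t) * (norm (lam *\<^sub>R v))\<^sup>2) \<and>
     (\<forall>zs \<in> operator_zeros T.
        norm (zs - zt) \<le> norm (zs - z) / sqrt (1 - \<sigma>\<^sup>2) \<and>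
        norm (zt - z) \<le> norm (zs - z) / sqrt (1 - \<sigma>\<^sup>2))"
proof -
  note err = assms(9)
  define F where "F = (\<lambda>z'. t * lam * \<gamma> z' + 1 / 2 * (norm (z' - z))\<^sup>2)"
  have F_eq: "F x = F zp + 1 / 2 * (norm (x - zp))\<^sup>2" for x
    unfolding F_def assms(10,11) by (rule affine_prox_decomposition)
  have F_min: "F zp \<le> F x" for x
    using F_eq[of x] by simp

  have "0 \<le> lam * \<epsilon>"
    using assms(2,7) by simp
  then have "(norm (lam *\<^sub>R v + zt - z))\<^sup>2 \<le> (\<sigma> * norm (zt - z))\<^sup>2"
    using err by (simp add: power_mult_distrib)
  then have res: "norm (lam *\<^sub>R v + zt - z) \<le> \<sigma> * norm (zt - z)"
    by (rule power2_le_imp_le) (use assms(3) in simp)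
  have "\<bar>norm (lam *\<^sub>R v) - norm (zt - z)\<bar> \<le> norm (lam *\<^sub>R v + zt - z)"
    using norm_triangle_ineq3[of "lam *\<^sub>R v" "- (zt - z)"]
    by (simp add: norm_minus_commute algebra_simps)
  with res have sandwich: "(1 - \<sigma>) * norm (zt - z) \<le> norm (lam *\<^sub>R v)"
      "norm (lam *\<^sub>R v) \<le> (1 + \<sigma>) * norm (zt - z)"
    by (simp_all add: algebra_simps)
  have eps: "2 * lam * \<epsilon> \<le> \<sigma>\<^sup>2 * (norm (zt - z))\<^sup>2"
    using err zero_le_power2[of "norm (lam *\<^sub>R v + zt - z)"] by linarith

  have argmin: "is_arg_min F (\<lambda>_. True) w \<longleftrightarrow> w = zp" for w
  proof
    assume "is_arg_min F (\<lambda>_. True) w"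
    then have "F w \<le> F zp"
      by (simp add: is_arg_min_linorder)
    then show "w = zp"
      using F_eq[of w] by simp
  qed (use F_min in \<open>simp add: is_arg_min_linorder\<close>)

  have "(LEAST m. m \<in> range F) = F zp"
    by (rule Least_equality) (use F_min in auto)
  moreover have "1 / 2 * ((1 - \<sigma>\<^sup>2) * t * (norm (zt - z))\<^sup>2 + t * (1 - t) * (norm (lam *\<^sub>R v))\<^sup>2)
      \<le> F zp"
    unfolding F_def assms(10,11) using assms(5) err by (rule prox_value_lower_bound)
  ultimately have least: "1 / 2 * ((1 - \<sigma>\<^sup>2) * t * (norm (zt - z))\<^sup>2
      + t * (1 - t) * (norm (lam *\<^sub>R v))\<^sup>2) \<le> (LEAST m. m \<in> range F)"
    by simp

  have sep: "inner (zs - zt) v - \<epsilon> \<le> 0" if "zs \<in> operator_zeros T" for zs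
    using assms(8) that by (rule enlargement_separates_zeros)
  have decrease: "(norm (zp - zs))\<^sup>2 + (1 - \<sigma>\<^sup>2) * t * (norm (zt - z))\<^sup>2
      + t * (1 - t) * (norm (lam *\<^sub>R v))\<^sup>2 \<le> (norm (z - zs))\<^sup>2" if "zs \<in> operator_zeros T" for zs
    unfolding assms(10)
    using relaxed_step_decrease[OF assms(5) _ err sep[OF that]] assms(2) by simp

  have bounds: "norm (zs - zt) \<le> norm (zs - z) / sqrt (1 - \<sigma>\<^sup>2)"
      "norm (zt - z) \<le> norm (zs - z) / sqrt (1 - \<sigma>\<^sup>2)" if "zs \<in> operator_zeros T" for zs
  proof -
    have "(norm ((z - lam *\<^sub>R v) - zs))\<^sup>2 + (1 - \<sigma>\<^sup>2) * (norm (zt - z))\<^sup>2 \<le> (norm (zs - z))\<^sup>2"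
      using relaxed_step_decrease[of 1, OF _ _ err sep[OF that]] assms(2)
      by (simp add: norm_minus_commute[of zs z])
    from distance_bounds_from_full_step[OF assms(3,4) res this]
    show "norm (zs - zt) \<le> norm (zs - z) / sqrt (1 - \<sigma>\<^sup>2)"
      "norm (zt - z) \<le> norm (zs - z) / sqrt (1 - \<sigma>\<^sup>2)"
      by simp_all
  qed

  show ?thesis
    using sandwich eps argmin least sep decrease bounds
    unfolding F_def assms(11) by blast
qed

end
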